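(* Let $\beta\in(0,1)$, $p\in(0,1)$ and $q=1-p$. Let $(Y_k)_{k\in\mathbb{N}_0}$ be an i.i.d. sequence with common distribution function $F_{\beta,p}$ and let $M_n^{\circ}=\max\{Y_0,\ldots,Y_{n-1}\}$. Then, as $n\to\infty$, $$\sup_{x\in\mathbb{R}}\left|\mathbb{P}\left(a_n^{\circ}(M_n^{\circ}-1)\le x\right)-\left(H_{\beta,q}(x)\right)^{r_n}\right|\to0.$$
   Context: For $\beta,p\in(0,1)$, let $(\varepsilon_j)_{j\in\mathbb{Z}}$ be i.i.d. with $\mathbb{P}(\varepsilon_j=0)=p$ and $\mathbb{P}(\varepsilon_j=1-\beta)=1-p$. $F_{\beta,p}$ denotes the distribution function of $\sum_{j=0}^\infty\beta^j\varepsilon_{-j}$ (the stationary distribution function of the AR(1) process $X_{k+1}=\beta X_k+\varepsilon_{k+1}$). $F_{\beta,q}$ denotes the same object with $p$ replaced by $q=1-p$. The function $\nu_{\beta,q}^{\to}:\mathbb{R}\to(0,\infty)$ is the (existing, unique, continuous) $\log(1/\beta)$-periodic function such that $F_{\beta,q}(y)=y^{\log q/\log\beta}\,\nu_{\beta,q}^{\to}(\log y)$ for all $y\in(0,1)$ if $\beta\in(0,\frac12]$, respectively for all $y\in(0,\frac1\beta-1]$ if $\beta\in(\frac12,1)$. Define $$H_{\beta,q}(x)=\exp\left(-(-x)^{\log q/\log\beta}\,\nu_{\beta,q}^{\to}(\log(-x))\right)\text{ for }x<0,\qquad H_{\beta,q}(x)=1\text{ for }x\ge0.$$ Let $k(n)=\lfloor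 q^{-n}\rfloor$. For $n\ge k(1)$ write $n=k(m_n)r_n$, where $m_n\in\mathbb{N}$ is uniquely determined by $k(m_n)\le n<k(m_n+1)$ and $r_n=n/k(m_n)\ge1$. Set $a_n^{\circ}=\beta^{-m_n}$. *)

theory Defs
  imports "HOL-Probability.Probability"
begin

definition innovation :: "real \<Rightarrow> real \<Rightarrow> real pmf" where
  "innovation \<beta> p = map_pmf (\<lambda>b. if b then 0 else 1 - \<beta>) (bernoulli_pmf p)"

definition stat_law :: "real \<Rightarrow> real \<Rightarrow> real measure" where
  "stat_law \<beta> p =
     distr (Pi\<^sub>M (UNIV :: int set) (\<lambda>_. measure_pmf (innovation \<beta> p))) borel
       (\<lambda>\<epsilon>. \<Sum>j::nat. \<beta> ^ j * \<epsilon> (- int j))"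

definition F :: "real \<Rightarrow> real \<Rightarrow> real \<Rightarrow> real" where
  "F \<beta> p = cdf (stat_law \<beta> p)"

definition scaling_range :: "real \<Rightarrow> real set" where
  "scaling_range \<beta> = (if \<beta> \<le> 1 / 2 then {0<..<1} else {0<..1 / \<beta> - 1})"

definition is_nu :: "real \<Rightarrow> real \<Rightarrow> (real \<Rightarrow> real) \<Rightarrow> bool" where
  "is_nu \<beta> q \<nu> \<longleftrightarrow>
     continuous_on UNIV \<nu> \<and>
     (\<forall>t. 0 < \<nu> t) \<and>
     (\<forall>t. \<nu> (t + ln (1 / \<beta>)) = \<nu> t) \<and>
     (\<forall>y\<in>scaling_range \<beta>. F \<beta> q y = y powr (ln q / ln \<beta>) * \<nu> (ln y))"

text \<open>
  For \<open>\<beta>\<close> and \<open>q\<close> strictly between 0 and 1 there is exactly one such function: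
  the logarithm of \<open>scaling_range\<close> contains a full period, and on it
  \<open>F \<beta> q (\<beta> * y) = q * F \<beta> q y\<close>.
\<close>

definition nu :: "real \<Rightarrow> real \<Rightarrow> real \<Rightarrow> real" where
  "nu \<beta> q = (THE \<nu>. is_nu \<beta> q \<nu>)"

definition H :: "real \<Rightarrow> real \<Rightarrow> real \<Rightarrow> real" where
  "H \<beta> q x =
     (if x < 0 then exp (- ((- x) powr (ln q / ln \<beta>) * nu \<beta> q (ln (- x)))) else 1)"

definition k_seq :: "real \<Rightarrow> nat \<Rightarrow> nat" where
  "k_seq q n = nat \<lfloor>1 / q ^ n\<rfloor>"

text \<open>The next three sequences are meaningful only for \<open>n \<ge> k_seq q 1\<close>.\<close>

definition m_seq :: "real \<Rightarrow> nat \<Rightarrow> nat" where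
  "m_seq q n = (THE m. 1 \<le> m \<and> k_seq q m \<le> n \<and> n < k_seq q (m + 1))"

definition r_seq :: "real \<Rightarrow> nat \<Rightarrow> real" where
  "r_seq q n = real n / real (k_seq q (m_seq q n))"

definition a_seq :: "real \<Rightarrow> real \<Rightarrow> nat \<Rightarrow> real" where
  "a_seq \<beta> q n = 1 / \<beta> ^ m_seq q n"

end

theory Submission
  imports Defs "HOL-Real_Asymp.Real_Asymp"
begin

text \<open>
  Write \<open>c = 1 / \<beta> - 1\<close>. Conditioning on the most recent innovation gives
  \<open>F (\<beta> y) = q F y + (1 - q) F (y - c)\<close> for \<open>F = F \<beta> q\<close>, hence \<open>F (\<beta> y) = q F y\<close> for \<open>y \<le> c\<close>,
  and the same recursion excludes atoms. So the sequence \<open>F (\<beta>^n y) / q^n\<close> is eventually constant,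
  and its limit \<open>G y\<close> satisfies \<open>H \<beta> q x = exp (- G (- x))\<close> for \<open>x < 0\<close>.
  As \<open>1 - X\<close> has distribution function \<open>F \<beta> (1 - q)\<close>, the maximum has distribution function
  \<open>(1 - u)^n\<close> with \<open>u = F (\<beta>^m (- x))\<close>. While \<open>\<beta>^m (- x) \<le> c\<close>, this is compared with
  \<open>exp (- r u / q^m)\<close>, where \<open>r / q^m\<close> and \<open>n\<close> differ by at most \<open>r\<close>; the errors are
  bounded uniformly in \<open>u \<in> [0, 1]\<close>. For more negative \<open>x\<close> both sides are
  exponentially small in \<open>n\<close> by monotonicity.
\<close>

text \<open>The coordinates are independent under a product measure, composing each with
  \<open>f i\<close> keeps them independent, and independent variables have the product of their
  marginals as joint law. This transports the reflection of a single innovation to the whole noise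
  sequence.\<close>

lemma distr_PiM_map_components:
  assumes "I \<noteq> {}" and M: "\<And>i. i \<in> I \<Longrightarrow> prob_space (M i)"
    and f: "\<And>i. i \<in> I \<Longrightarrow> f i \<in> measurable (M i) (N i)"
  shows "distr (Pi\<^sub>M I M) (Pi\<^sub>M I N) (\<lambda>\<omega>. \<lambda>i\<in>I. f i (\<omega> i)) = Pi\<^sub>M I (\<lambda>i. distr (M i) (N i) (f i))"
proof -
  interpret P: prob_space "Pi\<^sub>M I M" by (rule prob_space_PiM) (rule M)
  have "distr (Pi\<^sub>M I M) (Pi\<^sub>M I M) (\<lambda>\<omega>. \<lambda>i\<in>I. \<omega> i) = distr (Pi\<^sub>M I M) (Pi\<^sub>M I M) (\<lambda>\<omega>. \<omega>)"
    by (rule distr_cong) (auto simp: space_PiM PiE_restrict)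
  also have "\<dots> = Pi\<^sub>M I (\<lambda>i. distr (Pi\<^sub>M I M) (M i) (\<lambda>\<omega>. \<omega> i))"
    by (subst distr_id2) (auto intro!: PiM_cong distr_PiM_component[symmetric] M)
  finally have "P.indep_vars M (\<lambda>i \<omega>. \<omega> i) I"
    by (subst P.indep_vars_iff_distr_eq_PiM') (use \<open>I \<noteq> {}\<close> in auto)
  then have "P.indep_vars N (\<lambda>i \<omega>. f i (\<omega> i)) I"
    by (rule P.indep_vars_compose2) (rule f)
  then have "distr (Pi\<^sub>M I M) (Pi\<^sub>M I N) (\<lambda>\<omega>. \<lambda>i\<in>I. f i (\<omega> i))
      = Pi\<^sub>M I (\<lambda>i. distr (Pi\<^sub>M I M) (N i) (\<lambda>\<omega>. f i (\<omega> i)))"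
    by (subst (asm) P.indep_vars_iff_distr_eq_PiM') (use \<open>I \<noteq> {}\<close> f in auto)
  also have "\<dots> = Pi\<^sub>M I (\<lambda>i. distr (M i) (N i) (f i))"
  proof (rule PiM_cong[OF refl])
    fix i assume i: "i \<in> I"
    have "distr (Pi\<^sub>M I M) (N i) (\<lambda>\<omega>. f i (\<omega> i)) = distr (distr (Pi\<^sub>M I M) (M i) (\<lambda>\<omega>. \<omega> i)) (N i) (f i)"
      using i f[OF i] by (subst distr_distr) (auto simp: comp_def)
    then show "distr (Pi\<^sub>M I M) (N i) (\<lambda>\<omega>. f i (\<omega> i)) = distr (M i) (N i) (f i)"
      using distr_PiM_component[of I M i, OF M i] by simp
  qed
  finally show ?thesis .
qed

section \<open>Estimates for powers and exponentials\<close>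

lemma power_diff_le:
  fixes a b :: real
  assumes "0 \<le> b" "b \<le> a"
  shows "a ^ Suc n - b ^ Suc n \<le> (real n + 1) * (a - b) * a ^ n"
proof (induction n)
  case (Suc n)
  have "a ^ Suc (Suc n) - b ^ Suc (Suc n) = a * (a ^ Suc n - b ^ Suc n) + (a - b) * b ^ Suc n"
    by (simp add: algebra_simps)
  also have "\<dots> \<le> a * ((real n + 1) * (a - b) * a ^ n) + (a - b) * a ^ Suc n"
    using Suc assms by (intro add_mono mult_left_mono power_mono) auto
  finally show ?case by (simp add: algebra_simps)
qed simp

text \<open>The quadratic truncations at \<open>u\<close> and \<open>- u\<close> multiply to
  \<open>1 + u ^ 4 / 4\<close>, which is at least 1, so the lower bound for \<open>exp u\<close>
  turns into an upper bound for its inverse.\<close>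

lemma exp_minus_le_quadratic: "exp (- u) \<le> 1 - u + u\<^sup>2 / 2" if "0 \<le> u" for u :: real
proof -
  have "0 \<le> 1 - u + u\<^sup>2 / 2"
    using zero_le_power2[of "u - 1"] by (simp add: power2_eq_square algebra_simps)
  then have "(1 + u + u\<^sup>2 / 2) * (1 - u + u\<^sup>2 / 2) \<le> exp u * (1 - u + u\<^sup>2 / 2)"
    by (rule mult_right_mono[OF exp_lower_Taylor_quadratic[OF that]])
  moreover have "(1 + u + u\<^sup>2 / 2) * (1 - u + u\<^sup>2 / 2) = 1 + (u\<^sup>2)\<^sup>2 / 4"
    by (simp add: power2_eq_square algebra_simps)
  ultimately have "1 \<le> exp u * (1 - u + u\<^sup>2 / 2)"
    using zero_le_power2[of "u\<^sup>2"] by linarith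
  then show ?thesis by (simp add: exp_minus field_simps)
qed

lemma square_mult_exp_minus_le: "v\<^sup>2 * exp (- v) \<le> 2" if "0 \<le> v" for v :: real
proof -
  have "v\<^sup>2 \<le> 2 * exp v" using exp_lower_Taylor_quadratic[OF that] that by simp
  then show ?thesis by (simp add: exp_minus field_simps)
qed

text \<open>The difference of the powers is at most
  \<open>n * (u\<^sup>2 / 2) * exp (- u) ^ (n - 1)\<close>. With \<open>v = n * u\<close> this is
  \<open>exp u * v\<^sup>2 * exp (- v) / (2 * n)\<close>; as \<open>exp u\<close> is at most 3 and
  \<open>v\<^sup>2 * exp (- v)\<close> at most 2, the bound is uniform in \<open>u\<close>.\<close>

lemma power_one_minus_approx_exp:
  fixes u :: real
  assumes "0 \<le> u" "u \<le> 1" "0 < n"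
  shows "\<bar>(1 - u) ^ n - exp (- (real n * u))\<bar> \<le> 3 / real n"
proof -
  obtain k where n: "n = Suc k" using \<open>0 < n\<close> by (cases n) auto
  have exp_n: "exp (- (real n * u)) = exp (- u) ^ n" by (simp add: exp_of_nat_mult[symmetric])
  have le: "1 - u \<le> exp (- u)" using exp_ge_add_one_self[of "- u"] by simp
  then have "(1 - u) ^ n \<le> exp (- u) ^ n" using assms by (intro power_mono) auto
  moreover have "exp (- u) ^ n - (1 - u) ^ n \<le> real n * (exp (- u) - (1 - u)) * exp (- u) ^ k"
    using power_diff_le[of "1 - u" "exp (- u)" k] assms le by (simp add: n add.commute)
  moreover have "real n * (exp (- u) - (1 - u)) * exp (- u) ^ k \<le> real n * (u\<^sup>2 / 2) * exp (- u) ^ k"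
    using exp_minus_le_quadratic[OF \<open>0 \<le> u\<close>] by (intro mult_right_mono mult_left_mono) auto
  moreover have "real n * (u\<^sup>2 / 2) * exp (- u) ^ k
      = exp u * ((real n * u)\<^sup>2 * exp (- (real n * u))) / (2 * real n)"
  proof -
    have "exp (- u) ^ k = exp u * exp (- (real n * u))"
      by (simp add: n algebra_simps flip: exp_of_nat_mult exp_add)
    then show ?thesis using \<open>0 < n\<close> by (simp add: power2_eq_square field_simps)
  qed
  moreover have "exp u * ((real n * u)\<^sup>2 * exp (- (real n * u))) \<le> 3 * 2"
  proof (intro mult_mono square_mult_exp_minus_le)
    show "exp u \<le> 3" using exp_le assms(2) by (meson exp_le_cancel_iff order_trans)
  qed (use assms in auto)
  then have "exp u * ((real n * u)\<^sup>2 * exp (- (real n * u))) / (2 * real n) \<le> 3 / real n"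
    using \<open>0 < n\<close> by (simp add: field_simps)
  ultimately show ?thesis unfolding exp_n by linarith
qed

text \<open>A Lipschitz estimate alone would give \<open>d * u\<close>; the common factor
  \<open>exp (- (a * u))\<close> absorbs \<open>u\<close>, because
  \<open>a * u * exp (- (a * u))\<close> never exceeds 1.\<close>

lemma exp_minus_diff_le:
  fixes a b d u :: real
  assumes "0 \<le> u" "0 < a" "a \<le> b" "b \<le> a + d"
  shows "\<bar>exp (- (a * u)) - exp (- (b * u))\<bar> \<le> d / a"
proof -
  have "exp (- (b * u)) \<le> exp (- (a * u))" using assms by (simp add: mult_right_mono)
  moreover have "exp (- (a * u)) - exp (- (b * u)) = exp (- (a * u)) * (1 - exp (- ((b - a) * u)))"
    by (simp add: algebra_simps flip: exp_add)
  moreover have "\<dots> \<le> exp (- (a * u)) * (d * u)"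
  proof (intro mult_left_mono)
    have "1 - exp (- ((b - a) * u)) \<le> (b - a) * u" using exp_ge_add_one_self[of "- ((b - a) * u)"] by simp
    also have "\<dots> \<le> d * u" using assms by (intro mult_right_mono) auto
    finally show "1 - exp (- ((b - a) * u)) \<le> d * u" .
  qed auto
  moreover have "exp (- (a * u)) * (d * u) = d / a * (a * u / exp (a * u))"
    using assms by (simp add: exp_minus field_simps)
  moreover have "\<dots> \<le> d / a * 1"
  proof (intro mult_left_mono)
    show "a * u / exp (a * u) \<le> 1"
      using exp_ge_add_one_self[of "a * u"] by (simp add: divide_simps del: exp_ge_add_one_self)
  qed (use assms in auto)
  ultimately show ?thesis by linarith
qed

lemma (in prob_space) prob_Max_le:
  fixes Y :: "nat \<Rightarrow> 'a \<Rightarrow> real"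
  assumes "indep_vars (\<lambda>_. borel) Y UNIV" "0 < n"
  shows "prob {\<omega> \<in> space M. Max ((\<lambda>k. Y k \<omega>) ` {..<n}) \<le> t} = (\<Prod>k<n. cdf (distr M borel (Y k)) t)"
proof -
  have [measurable]: "Y k \<in> borel_measurable M" for k
    using assms by (auto simp: indep_vars_def)
  have "{\<omega> \<in> space M. Max ((\<lambda>k. Y k \<omega>) ` {..<n}) \<le> t} = (\<Inter>k\<in>{..<n}. Y k -` {..t} \<inter> space M)"
    using \<open>0 < n\<close> by (subst Max_le_iff) auto
  also have "prob \<dots> = (\<Prod>k<n. prob (Y k -` {..t} \<inter> space M))"
    by (rule indep_varsD[OF assms(1)]) (use \<open>0 < n\<close> in auto)
  also have "\<dots> = (\<Prod>k<n. cdf (distr M borel (Y k)) t)"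
    by (simp add: cdf_def measure_distr)
  finally show ?thesis .
qed

subsection \<open>The stationary law\<close>

text \<open>With time reversed and naturals as indices, a new most recent innovation can be
  prepended by \<open>case_nat\<close>.\<close>

definition geo_sum :: "real \<Rightarrow> (nat \<Rightarrow> real) \<Rightarrow> real" where
  "geo_sum \<beta> \<omega> = (\<Sum>j. \<beta> ^ j * \<omega> j)"

locale ar1 =
  fixes \<beta> q :: real
  assumes beta: "0 < \<beta>" "\<beta> < 1" and q: "0 < q" "q < 1"
begin

abbreviation "innov \<equiv> measure_pmf (innovation \<beta> q)"
abbreviation "noise \<equiv> Pi\<^sub>M (UNIV :: nat set) (\<lambda>_. innov)"
abbreviation "\<mu> \<equiv> stat_law \<beta> q"

lemma reflected: "ar1 \<beta> (1 - q)"
  using beta q by unfold_locales auto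

sublocale noise: sequence_space innov
  by unfold_locales

lemma measurable_geo_sum [measurable]: "geo_sum \<beta> \<in> borel_measurable noise"
proof -
  have [measurable]: "(\<lambda>\<omega>. \<omega> j) \<in> borel_measurable noise" for j :: nat
    by (rule measurable_compose[OF measurable_component_singleton]) auto
  show ?thesis unfolding geo_sum_def[abs_def] by measurable
qed

text \<open>The series only sees the coordinates \<open>- int n\<close>, and restricting a product
  measure along this injective reindexing gives the one-sided product.\<close>

lemma stat_law_eq_distr: "\<mu> = distr noise borel (geo_sum \<beta>)"
proof -
  let ?\<Omega> = "Pi\<^sub>M (UNIV :: int set) (\<lambda>_. innov)"
  have "noise = distr ?\<Omega> noise (\<lambda>\<omega>. \<lambda>n\<in>UNIV. \<omega> (- int n))"
    by (rule distr_PiM_reindex[symmetric]) (auto simp: inj_on_def intro: measure_pmf.prob_space_axioms)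
  also have "distr \<dots> borel (geo_sum \<beta>) = \<mu>"
    unfolding stat_law_def
    by (subst distr_distr) (auto simp: comp_def geo_sum_def intro!: measurable_PiM_single')
  finally show ?thesis ..
qed

lemma real_distribution_stat_law: "real_distribution \<mu>"
  unfolding stat_law_eq_distr by (rule noise.P.real_distribution_distr) measurable

sublocale law: real_distribution \<mu>
  by (rule real_distribution_stat_law)

text \<open>Off this event the series may diverge and \<open>suminf\<close> says nothing, so
  pathwise facts about \<open>geo_sum\<close> are used almost everywhere only.\<close>

lemma AE_noise: "AE \<omega> in noise. \<forall>j. \<omega> j = 0 \<or> \<omega> j = 1 - \<beta>"
proof -
  have "AE \<omega> in noise. \<omega> j = 0 \<or> \<omega> j = 1 - \<beta>" for j
    by (rule AE_PiM_component)
       (auto simp: AE_measure_pmf_iff innovation_def intro: measure_pmf.prob_space_axioms)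
  then show ?thesis by (subst AE_all_countable) auto
qed

lemma summable_geo_sum:
  assumes "\<forall>j. \<omega> j = 0 \<or> \<omega> j = 1 - \<beta>"
  shows "summable (\<lambda>j. \<beta> ^ j * \<omega> j)"
proof (rule summable_comparison_test')
  show "summable (\<lambda>j. \<beta> ^ j * (1 - \<beta>))"
    using beta by (intro summable_mult2 summable_geometric) auto
  show "norm (\<beta> ^ j * \<omega> j) \<le> \<beta> ^ j * (1 - \<beta>)" for j
    using beta assms[rule_format, of j] by (auto simp: abs_mult)
qed

lemma geo_sum_const: "(\<lambda>j. \<beta> ^ j * (1 - \<beta>)) sums 1"
  using sums_mult2[OF geometric_sums[of \<beta>], of "1 - \<beta>"] beta by simp

lemma geo_sum_bounds:
  assumes "\<forall>j. \<omega> j = 0 \<or> \<omega> j = 1 - \<beta>"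
  shows "0 \<le> geo_sum \<beta> \<omega>" "geo_sum \<beta> \<omega> \<le> 1"
proof -
  show "0 \<le> geo_sum \<beta> \<omega>" unfolding geo_sum_def
  proof (rule suminf_nonneg[OF summable_geo_sum[OF assms]])
    show "0 \<le> \<beta> ^ j * \<omega> j" for j
      using beta assms[rule_format, of j] by auto
  qed
  have "geo_sum \<beta> \<omega> \<le> (\<Sum>j. \<beta> ^ j * (1 - \<beta>))"
    unfolding geo_sum_def
  proof (rule suminf_le[OF _ summable_geo_sum[OF assms] sums_summable[OF geo_sum_const]])
    show "\<beta> ^ j * \<omega> j \<le> \<beta> ^ j * (1 - \<beta>)" for j
      using beta assms[rule_format, of j] by auto
  qed
  then show "geo_sum \<beta> \<omega> \<le> 1" using sums_unique[OF geo_sum_const] by simp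
qed

lemma geo_sum_case_nat:
  assumes "\<forall>j. \<omega> j = 0 \<or> \<omega> j = 1 - \<beta>"
  shows "geo_sum \<beta> (case_nat s \<omega>) = s + \<beta> * geo_sum \<beta> \<omega>"
proof -
  have "(\<lambda>j. \<beta> * (\<beta> ^ j * \<omega> j)) sums (\<beta> * geo_sum \<beta> \<omega>)"
    unfolding geo_sum_def by (intro sums_mult summable_sums summable_geo_sum assms)
  then have "(\<lambda>j. \<beta> ^ Suc j * case_nat s \<omega> (Suc j)) sums (\<beta> * geo_sum \<beta> \<omega>)"
    by (simp add: mult_ac)
  then have "(\<lambda>j. \<beta> ^ j * case_nat s \<omega> j) sums (\<beta> * geo_sum \<beta> \<omega> + \<beta> ^ 0 * case_nat s \<omega> 0)"
    by (rule sums_Suc)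
  then show ?thesis unfolding geo_sum_def by (simp add: sums_iff)
qed

lemma AE_stat_law: "AE x in \<mu>. 0 \<le> x \<and> x \<le> 1"
proof -
  have "AE \<omega> in noise. 0 \<le> geo_sum \<beta> \<omega> \<and> geo_sum \<beta> \<omega> \<le> 1"
    using AE_noise by eventually_elim (use geo_sum_bounds in auto)
  then show ?thesis unfolding stat_law_eq_distr by (subst AE_distr_iff) auto
qed

lemma nn_integral_innov:
  fixes f :: "real \<Rightarrow> ennreal"
  shows
  "(\<integral>\<^sup>+s. f s \<partial>innov) = q * f 0 + (1 - q) * f (1 - \<beta>)"
  using q unfolding innovation_def by (simp add: nn_integral_map_pmf mult_ac)

text \<open>Splitting off the most recent innovation \<open>s\<close> writes the sum as
  \<open>s + \<beta> * X'\<close> with \<open>X'\<close> an independent copy; Fubini and the two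
  values of \<open>s\<close> give the two terms.\<close>

lemma measure_stat_law_rec:
  assumes A [measurable]: "A \<in> sets borel"
  shows "measure \<mu> A = q * measure \<mu> {x. \<beta> * x \<in> A} + (1 - q) * measure \<mu> {x. 1 - \<beta> + \<beta> * x \<in> A}"
proof -
  have shift: "emeasure \<mu> {x. s + \<beta> * x \<in> A} = (\<integral>\<^sup>+\<omega>. indicator A (s + \<beta> * geo_sum \<beta> \<omega>) \<partial>noise)" for s
  proof -
    have "emeasure \<mu> {x. s + \<beta> * x \<in> A} = (\<integral>\<^sup>+x. indicator {x. s + \<beta> * x \<in> A} x \<partial>\<mu>)"
      by (rule nn_integral_indicator[symmetric]) (unfold law.events_eq_borel, measurable)
    also have "\<dots> = (\<integral>\<^sup>+\<omega>. indicator {x. s + \<beta> * x \<in> A} (geo_sum \<beta> \<omega>) \<partial>noise)"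
      unfolding stat_law_eq_distr by (rule nn_integral_distr) measurable
    finally show ?thesis by (simp add: indicator_def)
  qed
  have "emeasure \<mu> A = (\<integral>\<^sup>+x. indicator A x \<partial>\<mu>)" by simp
  also have "\<dots> = (\<integral>\<^sup>+\<omega>. indicator A (geo_sum \<beta> \<omega>) \<partial>noise)"
    unfolding stat_law_eq_distr by (rule nn_integral_distr) measurable
  also have "\<dots> = (\<integral>\<^sup>+\<omega>. indicator A (geo_sum \<beta> \<omega>) \<partial>distr (innov \<Otimes>\<^sub>M noise) noise (\<lambda>(s, \<omega>). case_nat s \<omega>))"
    by (simp only: noise.PiM_iter)
  also have "\<dots> = (\<integral>\<^sup>+z. indicator A (geo_sum \<beta> ((\<lambda>(s, \<omega>). case_nat s \<omega>) z)) \<partial>(innov \<Otimes>\<^sub>M noise))"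
    by (rule nn_integral_distr) measurable
  also have "\<dots> = (\<integral>\<^sup>+s. \<integral>\<^sup>+\<omega>. indicator A (geo_sum \<beta> (case_nat s \<omega>)) \<partial>noise \<partial>innov)"
    by (subst noise.P.nn_integral_fst[symmetric]) auto
  also have "\<dots> = (\<integral>\<^sup>+s. \<integral>\<^sup>+\<omega>. indicator A (s + \<beta> * geo_sum \<beta> \<omega>) \<partial>noise \<partial>innov)"
  proof (rule nn_integral_cong, rule nn_integral_cong_AE)
    fix s
    show "AE \<omega> in noise. (indicator A (geo_sum \<beta> (case_nat s \<omega>)) :: ennreal) = indicator A (s + \<beta> * geo_sum \<beta> \<omega>)"
      using AE_noise by eventually_elim (simp add: geo_sum_case_nat)
  qed
  also have "\<dots> = q * emeasure \<mu> {x. \<beta> * x \<in> A} + (1 - q) * emeasure \<mu> {x. 1 - \<beta> + \<beta> * x \<in> A}"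
    using shift[of 0] shift[of "1 - \<beta>"] by (simp add: nn_integral_innov)
  finally have "ennreal (measure \<mu> A) =
      ennreal (q * measure \<mu> {x. \<beta> * x \<in> A} + (1 - q) * measure \<mu> {x. 1 - \<beta> + \<beta> * x \<in> A})"
    using q by (simp add: law.emeasure_eq_measure ennreal_mult'')
  then show ?thesis using q by (subst (asm) ennreal_inj) auto
qed

text \<open>The map \<open>s \<mapsto> 1 - \<beta> - s\<close> swaps the two innovation values,
  hence the parameters \<open>q\<close> and \<open>1 - q\<close>; summed with weights
  \<open>\<beta> ^ j\<close> it becomes reflection at 1/2.\<close>

lemma distr_stat_law_reflect: "stat_law \<beta> (1 - q) = distr \<mu> borel (\<lambda>x. 1 - x)"
proof -
  interpret R: ar1 \<beta> "1 - q" by (rule reflected)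
  let ?g = "\<lambda>s. 1 - \<beta> - s"
  have reflect: "(\<lambda>\<omega> j. ?g (\<omega> j)) \<in> measurable noise noise"
    by (rule measurable_PiM_single')
       (auto intro!: measurable_compose[OF measurable_component_singleton])
  have bern: "map_pmf Not (bernoulli_pmf q) = bernoulli_pmf (1 - q)"
  proof (rule pmf_eqI)
    fix b
    \<comment> \<open>The double negation presents the argument as a value of \<open>Not\<close>,
      the form needed by \<open>pmf_map_inj'\<close>.\<close>
    have "pmf (map_pmf Not (bernoulli_pmf q)) (\<not> (\<not> b)) = pmf (bernoulli_pmf q) (\<not> b)"
      by (rule pmf_map_inj') (auto simp: inj_def)
    then show "pmf (map_pmf Not (bernoulli_pmf q)) b = pmf (bernoulli_pmf (1 - q)) b"
      using q by (cases b) auto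
  qed
  have "innovation \<beta> (1 - q) = map_pmf ?g (innovation \<beta> q)"
    unfolding innovation_def bern[symmetric] map_pmf_comp by (intro map_pmf_cong) auto
  then have "R.innov = distr innov innov ?g"
    by (auto simp: map_pmf_rep_eq intro: distr_cong)
  then have "R.noise = distr noise noise (\<lambda>\<omega>. \<lambda>j\<in>UNIV. ?g (\<omega> j))"
    by (subst distr_PiM_map_components) (auto intro: measure_pmf.prob_space_axioms)
  then have "stat_law \<beta> (1 - q) = distr (distr noise noise (\<lambda>\<omega> j. ?g (\<omega> j))) borel (geo_sum \<beta>)"
    unfolding R.stat_law_eq_distr by (simp add: restrict_def)
  also have "\<dots> = distr noise borel (\<lambda>\<omega>. geo_sum \<beta> (\<lambda>j. ?g (\<omega> j)))"
    by (subst distr_distr) (auto simp: comp_def intro!: measurable_geo_sum reflect)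
  also have "\<dots> = distr noise borel (\<lambda>\<omega>. 1 - geo_sum \<beta> \<omega>)"
  proof (rule distr_cong_AE)
    show "AE \<omega> in noise. geo_sum \<beta> (\<lambda>j. ?g (\<omega> j)) = 1 - geo_sum \<beta> \<omega>"
      using AE_noise
    proof eventually_elim
      case (elim \<omega>)
      from sums_diff[OF geo_sum_const summable_sums[OF summable_geo_sum[OF elim]]]
      show ?case unfolding geo_sum_def by (simp add: sums_iff algebra_simps)
    qed
    show "(\<lambda>\<omega>. geo_sum \<beta> (\<lambda>j. ?g (\<omega> j))) \<in> borel_measurable noise"
      by (rule measurable_compose[OF reflect measurable_geo_sum])
  qed auto
  also have "\<dots> = distr \<mu> borel (\<lambda>x. 1 - x)"
    unfolding stat_law_eq_distr by (subst distr_distr) (auto simp: comp_def)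
  finally show ?thesis .
qed

lemma measure_stat_law_outside:
  assumes "A \<in> sets borel" "A \<inter> {0..1} = {}"
  shows "measure \<mu> A = 0"
proof -
  have "AE x in \<mu>. x \<notin> A" using AE_stat_law by eventually_elim (use assms(2) in auto)
  then show ?thesis using assms(1) by (subst law.prob_eq_0) auto
qed

lemma measure_stat_law_singleton_rec:
  "measure \<mu> {x} = q * measure \<mu> {x / \<beta>} + (1 - q) * measure \<mu> {(x - (1 - \<beta>)) / \<beta>}"
proof -
  have "{y. \<beta> * y \<in> {x}} = {x / \<beta>}" "{y. 1 - \<beta> + \<beta> * y \<in> {x}} = {(x - (1 - \<beta>)) / \<beta>}"
    using beta by (auto simp: field_simps)
  then show ?thesis using measure_stat_law_rec[of "{x}"] by simp
qed

text \<open>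
  Were the supremum \<open>a\<close> of the atom masses positive, every atom would lose a fixed fraction
  of it: one of the two branches of the recursion, followed long enough, leaves \<open>{0..1}\<close>.
\<close>

lemma measure_stat_law_singleton: "measure \<mu> {x} = 0"
proof -
  define a where "a = (SUP x. measure \<mu> {x})"
  have bdd: "bdd_above (range (\<lambda>x. measure \<mu> {x}))"
    by (rule bdd_aboveI[of _ 1]) auto
  have le_a: "measure \<mu> {x} \<le> a" for x
    unfolding a_def by (rule cSUP_upper[OF _ bdd]) auto
  have a0: "0 \<le> a" using le_a[of 0] measure_nonneg[of \<mu> "{0}"] by linarith
  \<comment> \<open>With this \<open>N\<close>, any \<open>x\<close> not below
    \<open>1 - \<beta>\<close> satisfies \<open>x / \<beta> ^ N > 1\<close> and has left the
    support.\<close>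
  obtain N where N: "\<beta> ^ N < 1 - \<beta>"
    using real_arch_pow_inv[of "1 - \<beta>" \<beta>] beta by auto
  \<comment> \<open>The first branch is followed \<open>n\<close> times, each second branch being
    bounded by \<open>a\<close>; the weights of the latter add up to
    \<open>1 - q ^ n\<close>.\<close>
  have iter: "measure \<mu> {x} \<le> q ^ n * measure \<mu> {x / \<beta> ^ n} + (1 - q ^ n) * a" for n x
  proof (induction n)
    case (Suc n)
    have "measure \<mu> {x / \<beta> ^ n} \<le> q * measure \<mu> {x / \<beta> ^ Suc n} + (1 - q) * a"
      using measure_stat_law_singleton_rec[of "x / \<beta> ^ n"] q
        mult_left_mono[OF le_a[of "(x / \<beta> ^ n - (1 - \<beta>)) / \<beta>"], of "1 - q"]
      by (simp add: field_simps)
    then have "q ^ n * measure \<mu> {x / \<beta> ^ n} \<le> q ^ n * (q * measure \<mu> {x / \<beta> ^ Suc n} + (1 - q) * a)"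
      using q by (intro mult_left_mono) auto
    with Suc show ?case by (simp add: algebra_simps)
  qed simp
  define c where "c = max q (1 - q ^ N)"
  have c: "c < 1" using q by (simp add: c_def)
  have "measure \<mu> {x} \<le> c * a" for x
  proof (cases "x < 1 - \<beta>")
    case True
    then have "(x - (1 - \<beta>)) / \<beta> < 0" using beta by (simp add: field_simps)
    then have "measure \<mu> {(x - (1 - \<beta>)) / \<beta>} = 0" by (intro measure_stat_law_outside) auto
    then have "measure \<mu> {x} \<le> q * a"
      using measure_stat_law_singleton_rec[of x] mult_left_mono[OF le_a[of "x / \<beta>"], of q] q by simp
    also have "\<dots> \<le> c * a" using a0 by (intro mult_right_mono) (auto simp: c_def)
    finally show ?thesis .
  next
    case False
    then have "x / \<beta> ^ N > 1" using N beta by (simp add: field_simps)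
    then have "measure \<mu> {x / \<beta> ^ N} = 0" by (intro measure_stat_law_outside) auto
    then have "measure \<mu> {x} \<le> (1 - q ^ N) * a" using iter[of x N] by simp
    also have "\<dots> \<le> c * a" using a0 by (intro mult_right_mono) (auto simp: c_def)
    finally show ?thesis .
  qed
  then have "a \<le> c * a" unfolding a_def by (intro cSUP_least) auto
  then have "(1 - c) * a \<le> 0" by (simp add: algebra_simps)
  then have "a = 0" using c a0 by (simp add: mult_le_0_iff)
  then show ?thesis using le_a[of x] measure_nonneg[of \<mu> "{x}"] by linarith
qed

section \<open>Recursion, positivity and reflection of the distribution function\<close>

lemma isCont_F: "isCont (F \<beta> q) x"
  unfolding F_def law.isCont_cdf by (rule measure_stat_law_singleton)

lemma F_nonneg: "0 \<le> F \<beta> q x" and F_le_1: "F \<beta> q x \<le> 1"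
  unfolding F_def by (rule law.cdf_nonneg, rule law.cdf_bounded_prob)

lemma F_mono: "x \<le> y \<Longrightarrow> F \<beta> q x \<le> F \<beta> q y"
  unfolding F_def by (rule law.cdf_nondecreasing)

text \<open>The endpoint 0 itself relies on the absence of atoms. Including it makes the second term
  of \<open>F_rec\<close> vanish even at \<open>y = 1 / \<beta> - 1\<close>.\<close>

lemma F_eq_0: "F \<beta> q x = 0" if "x \<le> 0"
proof -
  have "F \<beta> q 0 = measure \<mu> {..<0} + measure \<mu> {0}"
    unfolding F_def cdf_def
    by (subst law.finite_measure_Union[symmetric]) (auto intro!: arg_cong[of _ _ "measure \<mu>"])
  also have "measure \<mu> {..<0} = 0" by (rule measure_stat_law_outside) auto
  finally show ?thesis
    using F_mono[OF that] F_nonneg[of x] by (simp add: measure_stat_law_singleton)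
qed

lemma F_eq_1: "F \<beta> q x = 1" if "1 \<le> x"
proof -
  have "measure \<mu> {x<..} = 0" using that by (intro measure_stat_law_outside) auto
  then have "F \<beta> q x = measure \<mu> {..x} + measure \<mu> {x<..}" by (simp add: F_def cdf_def)
  also have "\<dots> = measure \<mu> (space \<mu>)"
    by (subst law.finite_measure_Union[symmetric]) (auto intro!: arg_cong[of _ _ "measure \<mu>"])
  finally show ?thesis using law.prob_space by simp
qed

lemma F_rec: "F \<beta> q (\<beta> * y) = q * F \<beta> q y + (1 - q) * F \<beta> q (y - (1 / \<beta> - 1))"
proof -
  have "{x. \<beta> * x \<in> {..\<beta> * y}} = {..y}" "{x. 1 - \<beta> + \<beta> * x \<in> {..\<beta> * y}} = {..y - (1 / \<beta> - 1)}"
    using beta by (auto simp: field_simps)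
  then show ?thesis using measure_stat_law_rec[of "{..\<beta> * y}"] by (simp add: F_def cdf_def)
qed

lemma F_scale_power:
  assumes "0 \<le> y" "y \<le> 1 / \<beta> - 1"
  shows "F \<beta> q (\<beta> ^ n * y) = q ^ n * F \<beta> q y"
proof (induction n)
  case (Suc n)
  have "\<beta> ^ n * y \<le> 1 * y" using assms beta by (intro mult_right_mono power_le_one) auto
  then have "F \<beta> q (\<beta> * (\<beta> ^ n * y)) = q * F \<beta> q (\<beta> ^ n * y)"
    using assms unfolding F_rec by (simp add: F_eq_0)
  with Suc show ?case by (simp add: mult_ac)
qed simp

text \<open>If the \<open>n\<close> most recent innovations vanish, which has probability
  \<open>q ^ n\<close>, the sum is at most \<open>\<beta> ^ n\<close>; the induction expresses this
  through the first branch of \<open>F_rec\<close>.\<close>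

lemma F_pos: "0 < F \<beta> q y" if "0 < y"
proof -
  have "q ^ n \<le> F \<beta> q (\<beta> ^ n)" for n
  proof (induction n)
    case (Suc n)
    have "q * q ^ n \<le> q * F \<beta> q (\<beta> ^ n)" using Suc q by simp
    also have "\<dots> \<le> F \<beta> q (\<beta> * \<beta> ^ n)" unfolding F_rec using q F_nonneg by simp
    finally show ?case by simp
  qed (simp add: F_eq_1)
  moreover obtain N where "\<beta> ^ N < y" using real_arch_pow_inv[OF \<open>0 < y\<close>] beta by auto
  ultimately show ?thesis using F_mono[of "\<beta> ^ N" y] q
    by (meson less_le_trans less_imp_le zero_less_power)
qed

text \<open>Reflection turns a lower half-line into a closed upper one; without atoms, its measure
  is the complement of the distribution function.\<close>

lemma F_reflect: "F \<beta> (1 - q) (1 - y) = 1 - F \<beta> q y"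
proof -
  have "F \<beta> (1 - q) (1 - y) = measure \<mu> {y..}"
  proof -
    have "(\<lambda>x. 1 - x) -` {..1 - y} \<inter> space \<mu> = {y..}" by auto
    then show ?thesis unfolding F_def cdf_def distr_stat_law_reflect
      by (subst measure_distr) auto
  qed
  also have "measure \<mu> {y..} + (measure \<mu> {..y} - measure \<mu> {y}) = measure \<mu> (space \<mu>)"
  proof -
    have "measure \<mu> {..y} = measure \<mu> {..<y} + measure \<mu> {y}"
      by (subst law.finite_measure_Union[symmetric]) (auto intro!: arg_cong[of _ _ "measure \<mu>"])
    moreover have "measure \<mu> {..<y} + measure \<mu> {y..} = measure \<mu> (space \<mu>)"
      by (subst law.finite_measure_Union[symmetric]) (auto intro!: arg_cong[of _ _ "measure \<mu>"])
    ultimately show ?thesis by simp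
  qed
  then have "measure \<mu> {y..} = 1 - F \<beta> q y"
    using law.prob_space by (simp add: F_def cdf_def measure_stat_law_singleton)
  finally show ?thesis .
qed

lemma ex_power_mult_le: "\<exists>n. \<beta> ^ n * y \<le> e" if "0 < y" "0 < e" for y e :: real
proof -
  have "0 < e / y" using that by simp
  then obtain n where "\<beta> ^ n < e / y" using real_arch_pow_inv[of "e / y" \<beta>] beta by auto
  then have "\<beta> ^ n * y \<le> e" using that by (simp add: field_simps)
  then show ?thesis ..
qed

subsection \<open>The scaling limit and the periodic function\<close>

text \<open>For \<open>y > 0\<close> this is
  \<open>y powr (ln q / ln \<beta>) * nu \<beta> q (ln y)\<close>, the extension of
  \<open>F \<beta> q\<close> from small arguments by its scaling relation. A limit avoids choosing a
  power of \<open>\<beta>\<close> for each \<open>y\<close>.\<close>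

definition scaled_F :: "real \<Rightarrow> real" where
  "scaled_F y = lim (\<lambda>n. F \<beta> q (\<beta> ^ n * y) / q ^ n)"

text \<open>Once \<open>\<beta> ^ N * y\<close> is in the range of \<open>F_scale_power\<close>,
  further steps multiply numerator and denominator by the same power of \<open>q\<close>.\<close>

lemma scaled_F_eq:
  assumes "0 \<le> y" "\<beta> ^ N * y \<le> 1 / \<beta> - 1"
  shows "scaled_F y = F \<beta> q (\<beta> ^ N * y) / q ^ N"
proof -
  have "F \<beta> q (\<beta> ^ n * y) / q ^ n = F \<beta> q (\<beta> ^ N * y) / q ^ N" if "N \<le> n" for n
  proof -
    obtain i where n: "n = i + N" using le_Suc_ex[OF \<open>N \<le> n\<close>] by (auto simp: add.commute)
    show ?thesis
      using F_scale_power[of "\<beta> ^ N * y" i] assms beta q by (simp add: n power_add mult.assoc)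
  qed
  then have "(\<lambda>n. F \<beta> q (\<beta> ^ n * y) / q ^ n) \<longlonglongrightarrow> F \<beta> q (\<beta> ^ N * y) / q ^ N"
    by (intro tendsto_eventually eventually_sequentiallyI)
  then show ?thesis unfolding scaled_F_def by (rule limI)
qed

lemma scaled_F_divide: "scaled_F (y / \<beta>) = scaled_F y / q" if "0 < y"
proof -
  obtain N where N: "\<beta> ^ N * y \<le> 1 / \<beta> - 1"
    using ex_power_mult_le[OF \<open>0 < y\<close>, of "1 / \<beta> - 1"] beta by auto
  have "\<beta> ^ Suc N * (y / \<beta>) = \<beta> ^ N * y" using beta by simp
  then show ?thesis
    using scaled_F_eq[of "y / \<beta>" "Suc N"] scaled_F_eq[of y N] N that beta by simp
qed

lemma powr_exponent: "\<beta> powr (ln q / ln \<beta>) = q"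
  using beta q by (simp add: powr_def)

lemma le_if_scaling_range: "y \<in> scaling_range \<beta> \<Longrightarrow> 0 < y \<and> y \<le> 1 / \<beta> - 1"
proof (cases "\<beta> \<le> 1 / 2")
  case True
  then have "1 \<le> 1 / \<beta> - 1" using beta by (simp add: field_simps)
  then show "y \<in> scaling_range \<beta> \<Longrightarrow> ?thesis" using True by (auto simp: scaling_range_def)
qed (auto simp: scaling_range_def)

lemma ex_power_mult_scaling_range: "\<exists>n. \<beta> ^ n * y \<in> scaling_range \<beta>" if "0 < y"
proof -
  \<comment> \<open>Below both possible right ends of \<open>scaling_range\<close>; 1/2 stays clear
    of the open end 1.\<close>
  define e where "e = min (1 / 2) (1 / \<beta> - 1)"
  have "0 < e" using beta by (simp add: e_def)
  then obtain n where "\<beta> ^ n * y \<le> e" using ex_power_mult_le[OF \<open>0 < y\<close>] by blast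
  moreover have "0 < \<beta> ^ n * y" using beta that by simp
  ultimately show ?thesis by (intro exI[of _ n]) (auto simp: scaling_range_def e_def)
qed

lemma is_nu_scaled_F: "is_nu \<beta> q (\<lambda>t. scaled_F (exp t) / exp t powr (ln q / ln \<beta>))"
  unfolding is_nu_def
proof (intro conjI allI ballI)
  let ?\<alpha> = "ln q / ln \<beta>"
  let ?\<nu> = "\<lambda>t. scaled_F (exp t) / exp t powr ?\<alpha>"
  have c: "0 < 1 / \<beta> - 1" using beta by simp
  have "isCont ?\<nu> t" for t
  proof -
    \<comment> \<open>An \<open>N\<close> that works at \<open>t + 1\<close> works for every smaller
      argument, so near \<open>t\<close> the limit is one fixed continuous function.\<close>
    obtain N where N: "\<beta> ^ N * exp (t + 1) \<le> 1 / \<beta> - 1"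
      using ex_power_mult_le[OF _ c, of "exp (t + 1)"] by auto
    have eq: "F \<beta> q (\<beta> ^ N * exp s) / q ^ N = scaled_F (exp s)" if "s \<in> {..<t + 1}" for s
    proof -
      have "\<beta> ^ N * exp s \<le> \<beta> ^ N * exp (t + 1)" using that beta by auto
      then show ?thesis by (subst scaled_F_eq[of "exp s" N]) (use N in auto)
    qed
    have "continuous_on {..<t + 1} (\<lambda>s. F \<beta> q (\<beta> ^ N * exp s) / q ^ N / exp s powr ?\<alpha>)"
    proof (intro continuous_intros)
      show "continuous_on {..<t + 1} (\<lambda>s. F \<beta> q (\<beta> ^ N * exp s))"
        by (rule continuous_on_compose2[of UNIV "F \<beta> q"])
           (auto intro!: continuous_intros continuous_at_imp_continuous_on simp: isCont_F)
    qed (use q in auto)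
    then have "continuous_on {..<t + 1} ?\<nu>"
      using eq by (subst (asm) continuous_on_cong[OF refl]) auto
    then show ?thesis by (rule continuous_on_interior) (simp add: interior_open)
  qed
  then show "continuous_on UNIV ?\<nu>" by (simp add: continuous_at_imp_continuous_on)
  show "0 < ?\<nu> t" for t
  proof -
    obtain N where "\<beta> ^ N * exp t \<le> 1 / \<beta> - 1" using ex_power_mult_le[OF _ c, of "exp t"] by auto
    then show ?thesis using F_pos[of "\<beta> ^ N * exp t"] beta q by (simp add: scaled_F_eq)
  qed
  \<comment> \<open>One period divides \<open>exp t\<close> by \<open>\<beta>\<close>, so both
    numerator and denominator gain the factor \<open>1 / q\<close>.\<close>
  show "?\<nu> (t + ln (1 / \<beta>)) = ?\<nu> t" for t
  proof -
    have "exp (t + ln (1 / \<beta>)) = exp t / \<beta>" using beta by (simp add: exp_add)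
    then show ?thesis
      using beta q by (simp only: scaled_F_divide[OF exp_gt_zero]) (simp add: powr_divide powr_exponent exp_add)
  qed
  show "F \<beta> q y = y powr ?\<alpha> * ?\<nu> (ln y)" if "y \<in> scaling_range \<beta>" for y
    using le_if_scaling_range[OF that] scaled_F_eq[of y 0] by simp
qed

text \<open>Whole periods move any \<open>t\<close> into the logarithm of
  \<open>scaling_range\<close>, where the values of \<open>F \<beta> q\<close> determine the
  function.\<close>

lemma is_nu_unique:
  assumes "is_nu \<beta> q \<nu>"
  shows "\<nu> t = scaled_F (exp t) / exp t powr (ln q / ln \<beta>)"
proof -
  let ?\<alpha> = "ln q / ln \<beta>"
  obtain n where n: "\<beta> ^ n * exp t \<in> scaling_range \<beta>"
    using ex_power_mult_scaling_range[of "exp t"] by auto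
  have per: "\<nu> (s + ln (1 / \<beta>)) = \<nu> s" for s using assms by (simp add: is_nu_def)
  have "\<nu> (t + real i * ln \<beta>) = \<nu> t" for i
  proof (induction i)
    case (Suc i)
    have "\<nu> (t + real (Suc i) * ln \<beta>) = \<nu> (t + real (Suc i) * ln \<beta> + ln (1 / \<beta>))" by (rule per[symmetric])
    also have "t + real (Suc i) * ln \<beta> + ln (1 / \<beta>) = t + real i * ln \<beta>"
      using beta by (simp add: ln_div algebra_simps)
    finally show ?case using Suc by simp
  qed simp
  moreover have "ln (\<beta> ^ n * exp t) = t + real n * ln \<beta>"
    using beta by (simp add: ln_mult ln_realpow)
  moreover have "(\<beta> ^ n * exp t) powr ?\<alpha> = q ^ n * exp t powr ?\<alpha>"
  proof -
    have "(\<beta> ^ n) powr ?\<alpha> = (\<beta> powr ?\<alpha>) ^ n"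
      using beta by (simp add: powr_realpow[symmetric] powr_powr mult.commute)
    then show ?thesis using beta by (simp add: powr_mult powr_exponent)
  qed
  ultimately have "F \<beta> q (\<beta> ^ n * exp t) = q ^ n * exp t powr ?\<alpha> * \<nu> t"
    using assms n unfolding is_nu_def by metis
  then show ?thesis
    using scaled_F_eq[of "exp t" n] le_if_scaling_range[OF n] q by simp
qed

lemma nu_eq: "nu \<beta> q = (\<lambda>t. scaled_F (exp t) / exp t powr (ln q / ln \<beta>))"
  unfolding nu_def by (rule the_equality[where P = "is_nu \<beta> q"]) (auto intro: is_nu_scaled_F is_nu_unique)

lemma H_eq: "H \<beta> q x = exp (- scaled_F (- x))" if "x < 0"
  using that by (simp add: H_def nu_eq)

subsection \<open>Uniform error bound\<close>

lemma k_seq_le: "real (k_seq q m) \<le> 1 / q ^ m"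
  and k_seq_gt: "1 / q ^ m - 1 < real (k_seq q m)"
  using q unfolding k_seq_def by (simp_all add: of_nat_floor)

lemma k_seq_mono: "m \<le> m' \<Longrightarrow> k_seq q m \<le> k_seq q m'"
  unfolding k_seq_def using q by (intro nat_mono floor_mono divide_left_mono power_decreasing) auto

text \<open>Existence comes from the least \<open>m\<close> with \<open>n < k_seq q (m + 1)\<close>:
  minimality gives the lower inequality, and \<open>m = 1\<close> is covered by the hypothesis.
  Monotonicity of \<open>k_seq q\<close> gives uniqueness.\<close>

lemma m_seq_props:
  assumes "k_seq q 1 \<le> n"
  shows "k_seq q (m_seq q n) \<le> n" "n < k_seq q (m_seq q n + 1)"
proof -
  let ?P = "\<lambda>m. 1 \<le> m \<and> n < k_seq q (m + 1)"
  obtain N where N: "q ^ N < 1 / (real n + 1)"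
    using real_arch_pow_inv[of "1 / (real n + 1)" q] q by auto
  have "real n + 1 < 1 / q ^ N" using N q by (simp add: field_simps)
  then have "n < k_seq q N" using k_seq_gt[of N] by linarith
  also have "\<dots> \<le> k_seq q (Suc N + 1)" by (rule k_seq_mono) auto
  finally have ex: "?P (Suc N)" by simp
  define m where "m = (LEAST m. ?P m)"
  have m: "?P m" unfolding m_def by (rule LeastI[of ?P, OF ex])
  have "k_seq q m \<le> n"
  proof (cases "m = 1")
    case False
    then have "\<not> ?P (m - 1)" unfolding m_def by (intro not_less_Least) (use m m_def in auto)
    then show ?thesis using False m by auto
  qed (use assms in simp)
  with m have Q: "1 \<le> m \<and> k_seq q m \<le> n \<and> n < k_seq q (m + 1)" by simp
  have "m_seq q n = m" unfolding m_seq_def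
  proof (rule the_equality, rule Q)
    fix m' assume m': "1 \<le> m' \<and> k_seq q m' \<le> n \<and> n < k_seq q (m' + 1)"
    have "\<not> m + 1 \<le> m'" using k_seq_mono[of "m + 1" m'] Q m' by linarith
    moreover have "\<not> m' + 1 \<le> m" using k_seq_mono[of "m' + 1" m] Q m' by linarith
    ultimately show "m' = m" by linarith
  qed
  with Q show "k_seq q (m_seq q n) \<le> n" "n < k_seq q (m_seq q n + 1)" by auto
qed

text \<open>The first two error terms treat \<open>\<beta> ^ m * (- x)\<close> up to
  \<open>1 / \<beta> - 1\<close>: replacing the power by an exponential, then the rounding in
  \<open>k_seq\<close>. The last two bound each side separately beyond that threshold.\<close>

lemma extreme_bound_neg:
  fixes x :: real
  defines "f \<equiv> F \<beta> q (1 / \<beta> - 1)"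
  assumes n: "k_seq q 1 \<le> n" "1 < q * real n" and x: "x < 0"
  shows "\<bar>F \<beta> (1 - q) (1 + \<beta> ^ m_seq q n * x) ^ n - H \<beta> q x powr r_seq q n\<bar>
    \<le> 3 / n + 1 / (q * n - 1) + (1 - f) ^ n + exp (- (f * q * n))"
proof -
  define m k N r where "m = m_seq q n" and "k = real (k_seq q m)" and "N = 1 / q ^ m"
    and "r = r_seq q n"
  have n0: "0 < real n" using n(2) q by (metis less_trans zero_less_one zero_less_mult_pos)
  have kN: "k \<le> N" "N < k + 1" using k_seq_le[of m] k_seq_gt[of m] by (auto simp: k_def N_def)
  \<comment> \<open>The upper end of the block of \<open>n\<close> keeps \<open>N\<close> and
    \<open>k\<close> of order \<open>n\<close>, which makes the error terms explicit in
    \<open>n\<close>.\<close>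
  have "real n < 1 / q ^ (m + 1)" using m_seq_props(2)[OF n(1)] k_seq_le[of "m + 1"] by (auto simp: m_def)
  then have qn: "q * n < N" using q by (simp add: N_def field_simps)
  then have k: "q * n - 1 < k" "0 < k" using kN n(2) by auto
  have r: "n = k * r" "1 \<le> r"
    using k m_seq_props(1)[OF n(1)] by (auto simp: r_def r_seq_def k_def m_def)
  define y where "y = \<beta> ^ m * (- x)"
  have y: "0 < y" using beta x by (simp add: y_def mult_pos_neg)
  define u where "u = F \<beta> q y"
  have u: "0 \<le> u" "u \<le> 1" by (simp_all add: u_def F_nonneg F_le_1)
  have f: "0 \<le> f" "f \<le> 1" by (simp_all add: f_def F_nonneg F_le_1)
  have P: "F \<beta> (1 - q) (1 + \<beta> ^ m * x) = 1 - u"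
    using F_reflect[of y] by (simp add: y_def u_def)
  have Hr: "H \<beta> q x powr r = exp (- (r * scaled_F (- x)))"
    using x by (simp add: H_eq powr_def)
  show ?thesis
  proof (cases "y \<le> 1 / \<beta> - 1")
    case True
    have "scaled_F (- x) = N * u"
      using scaled_F_eq[of "- x" m] True x by (simp add: y_def u_def N_def)
    then have Hr': "H \<beta> q x powr r = exp (- (r * N * u))" by (simp add: Hr mult_ac)
    \<comment> \<open>Multiplying \<open>k \<le> N < k + 1\<close> by \<open>r\<close> shows that
      the two exponents differ by at most \<open>r\<close>; relative to \<open>n\<close> this is
      \<open>1 / k\<close>.\<close>
    have "real n \<le> r * N" using mult_left_mono[of k N r] kN r by (simp add: mult.commute)
    moreover have "r * N \<le> n + r" using mult_left_mono[of N "k + 1" r] kN r by (simp add: algebra_simps)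
    ultimately have "\<bar>exp (- (n * u)) - exp (- (r * N * u))\<bar> \<le> r / n"
      using u n0 by (intro exp_minus_diff_le) auto
    also have "r / n = 1 / k" using r k by simp
    also have "\<dots> \<le> 1 / (q * n - 1)" using k n by (intro divide_left_mono) auto
    finally have "\<bar>exp (- (n * u)) - exp (- (r * N * u))\<bar> \<le> 1 / (q * n - 1)" .
    moreover have "\<bar>(1 - u) ^ n - exp (- (n * u))\<bar> \<le> 3 / n"
      using u n0 by (intro power_one_minus_approx_exp) auto
    moreover have "0 \<le> (1 - f) ^ n" "0 \<le> exp (- (f * q * n))" using f by auto
    ultimately show ?thesis
      unfolding m_def[symmetric] r_def[symmetric] P Hr' by linarith
  next
    case False
    then have "f \<le> u" by (simp add: f_def u_def F_mono)
    then have 1: "(1 - u) ^ n \<le> (1 - f) ^ n" using u by (intro power_mono) auto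
    \<comment> \<open>Here \<open>y\<close> is still too large for scaling, so \<open>i\<close>
      further steps are taken. Comparison with the threshold after the same steps gives
      \<open>f * N \<le> scaled_F (- x)\<close>, and \<open>r \<ge> 1\<close> only helps.\<close>
    obtain i where i: "\<beta> ^ i * y \<le> 1 / \<beta> - 1"
      using ex_power_mult_le[OF y, of "1 / \<beta> - 1"] beta by auto
    have "q ^ i * f = F \<beta> q (\<beta> ^ i * (1 / \<beta> - 1))"
      unfolding f_def using beta by (intro F_scale_power[symmetric]) auto
    also have "\<dots> \<le> F \<beta> q (\<beta> ^ i * y)" using False beta by (intro F_mono mult_left_mono) auto
    finally have "q ^ i * f / q ^ (i + m) \<le> F \<beta> q (\<beta> ^ i * y) / q ^ (i + m)"
      using q by (intro divide_right_mono) auto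
    also have "\<dots> = scaled_F (- x)"
      using scaled_F_eq[of "- x" "i + m"] i x by (simp add: y_def power_add mult.assoc)
    finally have "f * N \<le> scaled_F (- x)" using q by (simp add: N_def power_add)
    moreover have "f * (q * n) \<le> f * N" using qn f by (intro mult_left_mono) auto
    moreover have "1 * scaled_F (- x) \<le> r * scaled_F (- x)"
      using \<open>f * N \<le> scaled_F (- x)\<close> f r k kN by (intro mult_right_mono) (auto intro: order_trans[OF _ \<open>f * N \<le> _\<close>])
    ultimately have "exp (- (r * scaled_F (- x))) \<le> exp (- (f * q * n))" by simp
    moreover have "0 \<le> (1 - u) ^ n" "0 \<le> 3 / real n" "0 \<le> 1 / (q * n - 1)" using u n by auto
    moreover have "0 \<le> exp (- (r * scaled_F (- x)))" by simp
    ultimately show ?thesis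
      using 1 unfolding m_def[symmetric] r_def[symmetric] P Hr by linarith
  qed
qed

text \<open>Positivity of \<open>F \<beta> q\<close> at the threshold makes the last two terms decay
  geometrically.\<close>

lemma extreme_bound_tendsto_0:
  "(\<lambda>n. 3 / real n + 1 / (q * real n - 1) + (1 - F \<beta> q (1 / \<beta> - 1)) ^ n
      + exp (- (F \<beta> q (1 / \<beta> - 1) * q * real n))) \<longlonglongrightarrow> 0"
proof -
  let ?f = "F \<beta> q (1 / \<beta> - 1)"
  have f: "0 < ?f" "?f \<le> 1" using beta by (auto intro!: F_pos F_le_1)
  have pow: "(\<lambda>n. (1 - ?f) ^ n) \<longlonglongrightarrow> 0" using f by (intro LIMSEQ_power_zero) auto
  have expo: "(\<lambda>n. exp (- (?f * q * real n))) \<longlonglongrightarrow> 0"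
  proof -
    have "(\<lambda>n. exp (- (?f * q)) ^ n) \<longlonglongrightarrow> 0" using f q by (intro LIMSEQ_power_zero) auto
    then show ?thesis by (simp add: mult.commute flip: exp_of_nat_mult)
  qed
  have "(\<lambda>n. 3 / real n + 1 / (q * real n - 1)) \<longlonglongrightarrow> 0" using q by real_asymp
  from tendsto_add[OF tendsto_add[OF this pow] expo] show ?thesis by simp
qed

end

section \<open>Uniform convergence for the maximum\<close>

theorem theorem3p1:
  fixes \<beta> p q :: real and M :: "'a measure" and Y :: "nat \<Rightarrow> 'a \<Rightarrow> real"
  assumes "0 < \<beta>" "\<beta> < 1" and "0 < p" "p < 1" and "q = 1 - p"
    and "prob_space M"
    and "prob_space.indep_vars M (\<lambda>_. borel) Y UNIV"
    and "\<And>k. cdf (distr M borel (Y k)) = F \<beta> p"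
  shows "(\<lambda>n. SUP x::real.
            \<bar>measure M {\<omega> \<in> space M. a_seq \<beta> q n * (Max ((\<lambda>k. Y k \<omega>) ` {..<n}) - 1) \<le> x}
              - H \<beta> q x powr r_seq q n\<bar>) \<longlonglongrightarrow> 0"
proof -
  interpret prob_space M by fact
  interpret ar1 \<beta> q using assms(1-5) by unfold_locales auto
  interpret R: ar1 \<beta> "1 - q" by (rule reflected)
  have p: "p = 1 - q" using assms(5) by simp
  let ?f = "F \<beta> q (1 / \<beta> - 1)"
  let ?b = "\<lambda>n. 3 / real n + 1 / (q * real n - 1) + (1 - ?f) ^ n + exp (- (?f * q * real n))"
  let ?d = "\<lambda>n x. \<bar>prob {\<omega> \<in> space M. a_seq \<beta> q n * (Max ((\<lambda>k. Y k \<omega>) ` {..<n}) - 1) \<le> x}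
              - H \<beta> q x powr r_seq q n\<bar>"
  have le: "?d n x \<le> ?b n" if n: "k_seq q 1 \<le> n" "1 < q * real n" for n x
  proof -
    have n0: "0 < n" using n(2) by (cases n) auto
    have "a_seq \<beta> q n * (z - 1) \<le> x \<longleftrightarrow> z \<le> 1 + \<beta> ^ m_seq q n * x" for z
      using assms(1) by (simp add: a_seq_def field_simps)
    then have prob_eq: "prob {\<omega> \<in> space M. a_seq \<beta> q n * (Max ((\<lambda>k. Y k \<omega>) ` {..<n}) - 1) \<le> x}
        = F \<beta> (1 - q) (1 + \<beta> ^ m_seq q n * x) ^ n"
      using prob_Max_le[OF assms(7) n0] assms(8) by (simp add: p)
    show ?thesis
    proof (cases "x < 0")
      case True
      show ?thesis unfolding prob_eq by (rule extreme_bound_neg[OF n True])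
    next
      case False
      \<comment> \<open>The threshold for the maximum is at least 1, the right end of the support,
        and \<open>H \<beta> q x = 1\<close>.\<close>
      then have "?d n x = 0" unfolding prob_eq using assms(1) by (simp add: R.F_eq_1 H_def)
      moreover have "0 \<le> ?b n" using n F_le_1[of "1 / \<beta> - 1"] by simp
      ultimately show ?thesis by linarith
    qed
  qed
  have ev: "\<forall>\<^sub>F n in sequentially. k_seq q 1 \<le> n \<and> 1 < q * real n"
    using q by (intro eventually_conj eventually_ge_at_top) real_asymp
  show ?thesis
  proof (rule tendsto_sandwich[OF _ _ tendsto_const extreme_bound_tendsto_0])
    show "\<forall>\<^sub>F n in sequentially. (SUP x. ?d n x) \<le> ?b n"
      using ev by eventually_elim (intro cSUP_least, use le in auto)
    show "\<forall>\<^sub>F n in sequentially. 0 \<le> (SUP x. ?d n x)"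
      using ev
    proof eventually_elim
      case (elim n)
      \<comment> \<open>A real supremum dominates its family only when that family is bounded above,
        which the bound uniform in \<open>x\<close> ensures.\<close>
      have "bdd_above (range (?d n))" using le elim by (intro bdd_aboveI[of _ "?b n"]) auto
      then show ?case by (rule cSUP_upper2[of _ _ 0]) auto
    qed
  qed
qed

end
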